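(* Let $m,n\geq2$, $d\geq0$, and $j\geq1$. Then the number of Fibonacci polyominoes $P\in\mathcal F_{m,n}$ with $\operatorname{des}(P)=d$ and $\operatorname{lmin}(P)=j$ equals \[ R(m,d+1,j)\binom{n-2}{m-1}+R(m-1,d,j-1)\binom{n-2}{m-2}. \]
   Context: A Fibonacci polyomino is a (nonempty) polyomino, considered up to translation, that is column-convex (each column is a contiguous segment of unit cells) and such that, reading columns from left to right, the bottom cell of each column lies exactly one unit above the bottom cell of the preceding column. Equivalently, it is given by a sequence of column heights $(h_1,\dots,h_m)$, $m\ge 1$, with $h_i\ge 2$ for $1\le i\le m-1$ and $h_m\ge 1$; column $i$ consists of the cells in column position $i$ and rows $i,i+1,\dots,i+h_i-1$. The horizontal (resp. vertical) semiperimeter is half the number of horizontal (resp. vertical) unit edges on the boundary (edges belonging to exactly one cell). $\mathcal F_{m,n}$ is the set of Fibonacci polyominoes with horizontal semiperimeter $m$ (equivalently $m$ columns) and vertical semiperimeter $n$. For $P$ with column heights $(h_1,\ldots,h_m)$: $\operatorname{des}(P)=|\{i:1\le i<m,\ h_i>h_{i+1}\}|$; $\operatorname{lmin}(P)$ is the number of left-to-right minima, i.e. of columns $i$ such that $i=1$ or $h_i<\min\{h_1,\ldots,h_{i-1}\}$. For $\ell\ge1$, $R(\ell,k,j)$ is the number of Dyck paths of semilength $\ell$ (paths from $(0,0)$ to $(2\ell,0)$ with steps $U=(1,1)$, $D=(1,-1)$ never going below the horizontal axis) with exactly $k$ peaks (consecutive steps $UD$) and exactly $j$ returns (down steps ending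 on the axis). It is known that $R(\ell,k,j)=\frac{j}{\ell}\binom{\ell}{k}\binom{\ell-j-1}{k-j}$ for $1\le j\le k\le\ell$, $j<\ell$; $R(\ell,\ell,\ell)=1$; and $R(\ell,k,j)=0$ otherwise. Binomial coefficients $\binom ab$ with $a\ge0$ vanish if $b<0$ or $b>a$. *)

theory Defs
  imports Complex_Main
begin

text \<open>The pair (x, y) stands for the unit cell with lower left corner (x, y).\<close>

type_synonym cell = "int \<times> int"

definition adjacent :: "cell \<Rightarrow> cell \<Rightarrow> bool" where
  "adjacent c c' \<longleftrightarrow> \<bar>fst c - fst c'\<bar> + \<bar>snd c - snd c'\<bar> = 1"

definition polyomino :: "cell set \<Rightarrow> bool" where
  "polyomino P \<longleftrightarrow> finite P \<and> P \<noteq> {} \<and>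
     (\<forall>c\<in>P. \<forall>c'\<in>P. (c, c') \<in> {(a, b). a \<in> P \<and> b \<in> P \<and> adjacent a b}\<^sup>*)"

definition translate :: "int \<times> int \<Rightarrow> cell set \<Rightarrow> cell set" where
  "translate t P = (\<lambda>(x, y). (x + fst t, y + snd t)) ` P"

definition translation_rel :: "(cell set \<times> cell set) set" where
  "translation_rel = {(P, Q). \<exists>t. Q = translate t P}"

definition column :: "cell set \<Rightarrow> int \<Rightarrow> int set" where
  "column P x = {y. (x, y) \<in> P}"

definition column_convex :: "cell set \<Rightarrow> bool" where
  "column_convex P \<longleftrightarrow> (\<forall>x. \<exists>a b. column P x = {a..b})"

text \<open>The nonempty columns of a polyomino occupy consecutive positions, so the column
  preceding the one at position x + 1 is the one at position x.\<close>

definition fibonacci_polyomino :: "cell set \<Rightarrow> bool" where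
  "fibonacci_polyomino P \<longleftrightarrow> polyomino P \<and> column_convex P \<and>
     (\<forall>x. column P x \<noteq> {} \<and> column P (x + 1) \<noteq> {} \<longrightarrow>
        Min (column P (x + 1)) = Min (column P x) + 1)"

text \<open>A horizontal unit edge is named by its left endpoint, a vertical one by its lower
  endpoint.\<close>

definition horizontal_edges :: "cell \<Rightarrow> (int \<times> int) set" where
  "horizontal_edges c = {(fst c, snd c), (fst c, snd c + 1)}"

definition vertical_edges :: "cell \<Rightarrow> (int \<times> int) set" where
  "vertical_edges c = {(fst c, snd c), (fst c + 1, snd c)}"

definition horizontal_semiperimeter :: "cell set \<Rightarrow> real" where
  "horizontal_semiperimeter P = real (card {e. \<exists>!c. c \<in> P \<and> e \<in> horizontal_edges c}) / 2"

definition vertical_semiperimeter :: "cell set \<Rightarrow> real" where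
  "vertical_semiperimeter P = real (card {e. \<exists>!c. c \<in> P \<and> e \<in> vertical_edges c}) / 2"

text \<open>Concrete Fibonacci polyominoes, before identifying translates.\<close>

definition fibonacci_polyominoes :: "nat \<Rightarrow> nat \<Rightarrow> cell set set" where
  "fibonacci_polyominoes m n = {P. fibonacci_polyomino P \<and>
     horizontal_semiperimeter P = real m \<and> vertical_semiperimeter P = real n}"

definition column_heights :: "cell set \<Rightarrow> nat list" where
  "column_heights P = map (\<lambda>x. card (column P x)) (sorted_list_of_set (fst ` P))"

definition des :: "cell set \<Rightarrow> nat" where
  "des P = (let h = column_heights P in card {i. Suc i < length h \<and> h ! i > h ! Suc i})"

definition lmin :: "cell set \<Rightarrow> nat" where
  "lmin P = (let h = column_heights P in
     card {i. i < length h \<and> (i = 0 \<or> h ! i < Min (set (take i h)))})"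

datatype step = Up | Down

definition level :: "step list \<Rightarrow> nat \<Rightarrow> int" where
  "level w i = (\<Sum>s\<leftarrow>take i w. case s of Up \<Rightarrow> 1 | Down \<Rightarrow> - 1)"

definition dyck_path :: "nat \<Rightarrow> step list \<Rightarrow> bool" where
  "dyck_path l w \<longleftrightarrow> length w = 2 * l \<and> level w (2 * l) = 0 \<and> (\<forall>i\<le>2 * l. level w i \<ge> 0)"

definition peaks :: "step list \<Rightarrow> nat" where
  "peaks w = card {i. Suc i < length w \<and> w ! i = Up \<and> w ! Suc i = Down}"

definition returns :: "step list \<Rightarrow> nat" where
  "returns w = card {i. i < length w \<and> w ! i = Down \<and> level w (Suc i) = 0}"

definition R :: "nat \<Rightarrow> nat \<Rightarrow> nat \<Rightarrow> nat" where
  "R l k j = card {w. dyck_path l w \<and> peaks w = k \<and> returns w = j}"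

lemma equiv_translation_rel: "equiv UNIV translation_rel"
proof (rule equivI)
  show "translation_rel \<subseteq> UNIV \<times> UNIV" by simp
  show "refl translation_rel"
  proof (rule refl_onI)
    fix P :: "cell set"
    have "P = translate (0, 0) P" by (simp add: translate_def)
    then show "(P, P) \<in> translation_rel" unfolding translation_rel_def by blast
  qed
  show "sym translation_rel"
  proof (rule symI)
    fix P Q assume "(P, Q) \<in> translation_rel"
    then obtain t where "Q = translate t P" by (auto simp: translation_rel_def)
    then have "P = translate (- fst t, - snd t) Q"
      by (simp add: translate_def image_image split_def)
    then show "(Q, P) \<in> translation_rel" unfolding translation_rel_def by blast
  qed
  show "trans translation_rel"
  proof (rule transI)
    fix P Q S assume "(P, Q) \<in> translation_rel" "(Q, S) \<in> translation_rel"
    then obtain s t where "Q = translate s P" "S = translate t Q"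
      by (auto simp: translation_rel_def)
    then have "S = translate (fst s + fst t, snd s + snd t) P"
      by (simp add: translate_def image_image split_def add.assoc)
    then show "(P, S) \<in> translation_rel" unfolding translation_rel_def by blast
  qed
qed

end

theory Submission
  imports Defs "HOL-Library.Tree"
begin

text \<open>A Fibonacci polyomino is determined up to translation by its column heights
  \<open>h\<^sub>1, \<dots>, h\<^sub>m\<close>, and its vertical semiperimeter is
  \<open>h\<^sub>1 + \<Sum>i. max 0 (h\<^sub>i\<^sub>+\<^sub>1 - h\<^sub>i + 1)\<close>. If the last height is 1, removing it lowers the numbers of
  descents and of left-to-right minima by one and keeps the semiperimeter; so it suffices to count
  sequences with all heights at least 2, that is, after subtracting 2, arbitrary sequences of natural
  numbers. Splitting such a sequence recursively at its leftmost minimum, and recording the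
  minimum relative to the one of the enclosing block, gives a binary tree with \<open>m\<close> nodes labelled by
  natural numbers. The semiperimeter becomes the sum of the labels plus \<open>m - 1\<close>, which accounts
  for the binomial coefficient, and under the usual bijection of binary trees with Dyck paths descents
  and left-to-right minima become peaks (minus one) and returns.\<close>

section \<open>Statistics of height sequences\<close>

text \<open>Stated for an arbitrary relation so that descents of heights and peaks of step words
  share the same concatenation rules.\<close>

definition pair_count :: "('a \<Rightarrow> 'a \<Rightarrow> bool) \<Rightarrow> 'a list \<Rightarrow> nat" where
  "pair_count Q xs = card {i. Suc i < length xs \<and> Q (xs ! i) (xs ! Suc i)}"

lemma pair_count_Nil [simp]: "pair_count Q [] = 0"
  by (simp add: pair_count_def)

lemma pair_count_singleton [simp]: "pair_count Q [x] = 0"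
  by (simp add: pair_count_def)

lemma pair_count_Cons_Cons:
  "pair_count Q (x # y # zs) = (if Q x y then 1 else 0) + pair_count Q (y # zs)"
proof -
  let ?A = "{i. Suc i < length (y # zs) \<and> Q ((y # zs) ! i) ((y # zs) ! Suc i)}"
  have "{i. Suc i < length (x # y # zs) \<and> Q ((x # y # zs) ! i) ((x # y # zs) ! Suc i)}
    = (if Q x y then {0} else {}) \<union> Suc ` ?A" (is "?L = ?R")
  proof (rule set_eqI)
    fix i
    show "i \<in> ?L \<longleftrightarrow> i \<in> ?R" by (cases i) auto
  qed
  moreover have "finite ?A" by simp
  ultimately show ?thesis
    by (auto simp: pair_count_def card_insert_if card_image)
qed

lemma pair_count_append:
  assumes "xs \<noteq> []" "ys \<noteq> []"
  shows "pair_count Q (xs @ ys) =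
    pair_count Q xs + (if Q (last xs) (hd ys) then 1 else 0) + pair_count Q ys"
  using assms(1)
proof (induction xs rule: induct_list012)
  case (2 x)
  then show ?case using assms(2) by (cases ys) (simp_all add: pair_count_Cons_Cons)
qed (simp_all add: pair_count_Cons_Cons)

lemma pair_count_map: "pair_count Q (map f xs) = pair_count (\<lambda>x y. Q (f x) (f y)) xs"
  by (auto simp: pair_count_def intro!: arg_cong[where f = card])

abbreviation descents :: "nat list \<Rightarrow> nat" where
  "descents \<equiv> pair_count (>)"

definition minima :: "nat list \<Rightarrow> nat" where
  "minima h = card {i. i < length h \<and> (i = 0 \<or> h ! i < Min (set (take i h)))}"

lemma minima_Nil [simp]: "minima [] = 0"
  by (simp add: minima_def)

lemma minima_snoc:
  "minima (xs @ [x]) = minima xs + (if \<forall>y \<in> set xs. x < y then 1 else 0)"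
proof -
  let ?A = "{i. i < length xs \<and> (i = 0 \<or> xs ! i < Min (set (take i xs)))}"
  have *: "(length xs = 0 \<or> x < Min (set xs)) = (\<forall>y \<in> set xs. x < y)"
    by (cases "xs = []") auto
  have "{i. i < length (xs @ [x]) \<and> (i = 0 \<or> (xs @ [x]) ! i < Min (set (take i (xs @ [x]))))}
    = ?A \<union> (if length xs = 0 \<or> x < Min (set xs) then {length xs} else {})"
    by (auto simp: nth_append less_Suc_eq split: if_splits)
  then show ?thesis unfolding minima_def * by simp
qed

text \<open>The entry \<open>x\<close> is a new minimum, and nothing after it is strictly smaller.
  Strict before and weak after is what characterises the leftmost minimum of a block.\<close>

lemma minima_append_Cons:
  assumes "\<forall>y \<in> set xs. x < y" "\<forall>y \<in> set ys. x \<le> y"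
  shows "minima (xs @ x # ys) = minima xs + 1"
  using assms(2)
proof (induction ys rule: rev_induct)
  case Nil
  then show ?case using assms(1) by (simp add: minima_snoc)
next
  case (snoc y ys)
  have "minima (xs @ x # ys @ [y]) = minima ((xs @ x # ys) @ [y])" by simp
  also have "\<dots> = minima (xs @ x # ys)" unfolding minima_snoc using snoc.prems by auto
  finally show ?case using snoc by simp
qed

lemma minima_map_add: "minima (map (\<lambda>x. x + c) xs) = minima xs"
  by (induction xs rule: rev_induct) (auto simp: minima_snoc)

text \<open>The truncated subtraction is intended: only the positive part of the rise counts.\<close>

fun rises :: "nat list \<Rightarrow> nat" where
  "rises (x # y # zs) = (y + 1 - x) + rises (y # zs)"
| "rises _ = 0"

text \<open>The vertical semiperimeter in terms of heights: each column starts one row above its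
  predecessor, so its top rises by \<open>y + 1 - x\<close> when this is positive.\<close>

definition ascent :: "nat list \<Rightarrow> nat" where
  "ascent h = (if h = [] then 0 else hd h + rises h)"

lemma rises_append:
  assumes "xs \<noteq> []" "ys \<noteq> []"
  shows "rises (xs @ ys) = rises xs + (hd ys + 1 - last xs) + rises ys"
  using assms(1)
proof (induction xs rule: induct_list012)
  case (2 x)
  then show ?case using assms(2) by (cases ys) simp_all
qed simp_all

lemma rises_map_add: "rises (map (\<lambda>x. x + c) xs) = rises xs"
  by (induction xs rule: rises.induct) simp_all

lemma ascent_map_add: "xs \<noteq> [] \<Longrightarrow> ascent (map (\<lambda>x. x + c) xs) = ascent xs + c"
  by (simp add: ascent_def rises_map_add hd_map)

text \<open>Even with truncated subtraction, \<open>y \<le> x' + (y + 1 - x')\<close>. The bound on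
  the entries yields finiteness of the sets to be counted.\<close>

lemma le_ascent: "x \<in> set h \<Longrightarrow> x \<le> ascent h"
proof (induction h rule: rises.induct)
  case (1 x' y zs)
  have "ascent (y # zs) \<le> ascent (x' # y # zs)" by (simp add: ascent_def)
  then show ?case using 1 by (auto simp: ascent_def)
qed (auto simp: ascent_def)

lemma finite_ascent_eq: "finite {h. length h = m \<and> ascent h = n}"
proof (rule finite_subset)
  show "{h. length h = m \<and> ascent h = n} \<subseteq> {h. set h \<subseteq> {..n} \<and> length h = m}"
    using le_ascent by auto
qed (simp add: finite_lists_length_eq)

section \<open>Height sequences, labelled trees and Dyck paths\<close>

text \<open>The label \<open>p\<close> is the excess of a block's minimum over the block's lower
  bound. Entries before the leftmost minimum are strictly larger, hence the shift
  \<open>p + 1\<close> on the left; ties may follow, hence the shift \<open>p\<close> on the right.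
  Every labelling is therefore admissible.\<close>

fun heights_of_tree :: "nat tree \<Rightarrow> nat list" where
  "heights_of_tree Leaf = []"
| "heights_of_tree (Node l p r) =
    map (\<lambda>x. x + (p + 1)) (heights_of_tree l) @ p # map (\<lambda>x. x + p) (heights_of_tree r)"

lemma length_heights_of_tree [simp]: "length (heights_of_tree t) = size t"
  by (induction t) auto

lemma heights_of_tree_eq_Nil [simp]: "heights_of_tree t = [] \<longleftrightarrow> t = Leaf"
  by (cases t) auto

lemma append_Cons_min_unique:
  fixes x x' :: nat
  assumes "xs @ x # ys = xs' @ x' # ys'"
    and "\<forall>y \<in> set xs. x < y" "\<forall>y \<in> set ys. x \<le> y"
    and "\<forall>y \<in> set xs'. x' < y" "\<forall>y \<in> set ys'. x' \<le> y"
  shows "xs = xs' \<and> x = x' \<and> ys = ys'"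
proof -
  have set_eq: "set (xs @ x # ys) = set (xs' @ x' # ys')" using assms(1) by simp
  have "x \<in> set (xs' @ x' # ys')" "x' \<in> set (xs @ x # ys)"
    using set_eq by auto
  then have x: "x = x'" using assms(2-) by fastforce
  \<comment> \<open>The hypotheses make \<open>x\<close> the minimum, and \<open>xs\<close> is the
    part before its first occurrence.\<close>
  have "xs = takeWhile (\<lambda>y. y \<noteq> x) (xs @ x # ys)" using assms(2)
    by (subst takeWhile_append2) auto
  moreover have "xs' = takeWhile (\<lambda>y. y \<noteq> x) (xs' @ x' # ys')" using assms(4) x
    by (subst takeWhile_append2) auto
  ultimately have "xs = xs'" using assms(1) by simp
  then show ?thesis using assms(1) by simp
qed

lemma inj_heights_of_tree: "inj heights_of_tree"
proof (rule injI)
  fix s t assume "heights_of_tree s = heights_of_tree t"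
  then show "s = t"
  proof (induction s arbitrary: t)
    case Leaf
    then show ?case by (metis heights_of_tree.simps(1) heights_of_tree_eq_Nil)
  next
    case (Node l p r)
    then obtain l' p' r' where t: "t = Node l' p' r'" by (cases t) auto
    have eqs: "map (\<lambda>x. x + (p + 1)) (heights_of_tree l) = map (\<lambda>x. x + (p' + 1)) (heights_of_tree l')
       \<and> p = p' \<and> map (\<lambda>x. x + p) (heights_of_tree r) = map (\<lambda>x. x + p') (heights_of_tree r')"
      by (rule append_Cons_min_unique) (use Node.prems t in auto)
    have inj: "inj (\<lambda>x::nat. x + c)" for c by (auto intro: injI)
    have "heights_of_tree l = heights_of_tree l'"
      using eqs inj_map_eq_map[OF inj[of "p + 1"]] by blast
    moreover have "heights_of_tree r = heights_of_tree r'"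
      using eqs inj_map_eq_map[OF inj[of p]] by blast
    ultimately show ?case using Node.IH eqs t by blast
  qed
qed

text \<open>Strong induction on the length: cut at the leftmost minimum, lower both parts by the
  shifts of \<open>heights_of_tree\<close> and encode them recursively.\<close>

lemma surj_heights_of_tree: "surj heights_of_tree"
proof -
  have "\<exists>t. heights_of_tree t = h" for h
  proof (induction "length h" arbitrary: h rule: less_induct)
    case less
    show ?case
    proof (cases "h = []")
      case True
      then show ?thesis by (intro exI[of _ Leaf]) simp
    next
      case False
      define x where "x = Min (set h)"
      have "x \<in> set h" using False by (simp add: x_def)
      then obtain xs ys where h: "h = xs @ x # ys" "x \<notin> set xs" by (meson split_list_first)
      have ge: "\<forall>y \<in> set h. x \<le> y" by (simp add: x_def)
      have gt: "\<forall>y \<in> set xs. x + 1 \<le> y" using ge h by (auto simp: Suc_le_eq intro: le_neq_trans)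
      obtain l where l: "heights_of_tree l = map (\<lambda>y. y - (x + 1)) xs"
        using less[of "map (\<lambda>y. y - (x + 1)) xs"] h by auto
      obtain r where r: "heights_of_tree r = map (\<lambda>y. y - x) ys"
        using less[of "map (\<lambda>y. y - x) ys"] h by auto
      have "map (\<lambda>y. y + (x + 1)) (heights_of_tree l) = xs"
        unfolding l map_map using gt by (intro map_idI) auto
      moreover have "map (\<lambda>y. y + x) (heights_of_tree r) = ys"
        unfolding r map_map using ge h by (intro map_idI) auto
      ultimately have "heights_of_tree (Node l x r) = h" using h by simp
      then show ?thesis by blast
    qed
  qed
  then show ?thesis unfolding surj_def by metis
qed

text \<open>The root contributes its label \<open>p\<close>, and each nonempty subtree contributes
  its own ascent plus 1: on the left because the first entry is lifted by \<open>p + 1\<close>, on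
  the right through the rise from \<open>p\<close>. So every node except the root costs one unit
  besides its label.\<close>

lemma ascent_heights_of_tree:
  "t \<noteq> Leaf \<Longrightarrow> ascent (heights_of_tree t) = sum_list (inorder t) + (size t - 1)"
proof (induction t)
  case (Node l p r)
  let ?L = "map (\<lambda>x. x + (p + 1)) (heights_of_tree l)"
  let ?R = "map (\<lambda>x. x + p) (heights_of_tree r)"
  have R: "rises (p # ?R) = (if r = Leaf then 0 else ascent (heights_of_tree r) + 1)"
    using rises_append[of "[p]" ?R]
    by (auto simp: ascent_def rises_map_add hd_map simp del: rises.simps(1))
  have L: "ascent (?L @ p # ?R) = (if l = Leaf then p else ascent ?L) + rises (p # ?R)"
  proof (cases "l = Leaf")
    case False
    \<comment> \<open>All entries of the left block are at least \<open>p + 1\<close>, so the step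
      from it down to \<open>p\<close> adds no rise.\<close>
    then have "p + 1 - last ?L = 0" by (simp add: last_map)
    then show ?thesis using False rises_append[of ?L "p # ?R"] by (simp add: ascent_def)
  qed (simp add: ascent_def)
  have "ascent ?L = ascent (heights_of_tree l) + (p + 1)" if "l \<noteq> Leaf"
    using that by (intro ascent_map_add) simp
  then show ?case using R L Node.IH by (cases l; cases r) auto
qed simp

section \<open>Dyck words of binary trees and their peaks\<close>

text \<open>Decomposition of a Dyck path by its last arch: \<open>l\<close> stays on the axis and
  \<open>r\<close> is lifted under the arch, so the returns correspond to the nodes on the left
  spine. Labels are ignored.\<close>

fun dyck_word :: "'a tree \<Rightarrow> step list" where
  "dyck_word Leaf = []"
| "dyck_word (Node l p r) = dyck_word l @ [Up] @ dyck_word r @ [Down]"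

lemma length_dyck_word [simp]: "length (dyck_word t) = 2 * size t"
  by (induction t) auto

lemma dyck_word_eq_Nil [simp]: "dyck_word t = [] \<longleftrightarrow> t = Leaf"
  by (cases t) auto

lemma dyck_word_map_tree [simp]: "dyck_word (map_tree f t) = dyck_word t"
  by (induction t) auto

lemma last_dyck_word: "t \<noteq> Leaf \<Longrightarrow> last (dyck_word t) = Down"
  by (cases t) auto

lemma hd_dyck_word: "t \<noteq> Leaf \<Longrightarrow> hd (dyck_word t) = Up"
proof (induction t)
  case (Node l p r)
  then show ?case by (cases "l = Leaf") auto
qed simp

lemma peaks_eq_pair_count: "peaks = pair_count (\<lambda>a b. a = Up \<and> b = Down)"
  by (simp add: fun_eq_iff peaks_def pair_count_def)

text \<open>An arch over the empty word is itself a peak. A nonempty word starts with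
  \<open>Up\<close>, ends with \<open>Down\<close> and has a peak already, so an arch over it adds
  none; \<open>max 1\<close> covers both cases. No peak arises where \<open>l\<close> meets the
  arch.\<close>

lemma peaks_dyck_word_Node:
  "peaks (dyck_word (Node l p r)) = peaks (dyck_word l) + max 1 (peaks (dyck_word r))"
proof -
  have "peaks ([Up] @ dyck_word r @ [Down]) = max 1 (peaks (dyck_word r))"
  proof (cases "r = Leaf")
    case True
    then show ?thesis by (simp add: peaks_eq_pair_count pair_count_Cons_Cons)
  next
    case False
    have *: "peaks (dyck_word r) \<ge> 1" if "r \<noteq> Leaf" for r :: "'a tree"
      using that
    proof (induction r)
      case (Node l p r)
      show ?case
      proof (cases "r = Leaf")
        case True
        then show ?thesis
          by (cases "l = Leaf")
            (simp_all add: peaks_eq_pair_count pair_count_Cons_Cons pair_count_append)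
      next
        case False
        then show ?thesis using Node.IH
          by (cases "l = Leaf")
            (simp_all add: peaks_eq_pair_count pair_count_append[of "[Up]", simplified] pair_count_append)
      qed
    qed simp
    have "peaks ([Up] @ dyck_word r @ [Down]) = peaks (dyck_word r)"
      using False unfolding peaks_eq_pair_count
      by (subst pair_count_append; simp add: hd_dyck_word)
         (subst pair_count_append; simp add: last_dyck_word)
    then show ?thesis using *[OF False] by simp
  qed
  then show ?thesis
    by (cases "l = Leaf") (auto simp: peaks_eq_pair_count pair_count_append last_dyck_word)
qed

text \<open>Both sides obey the same recursion: a nonempty left block ends above \<open>p\<close>,
  which gives one descent, while the right block starts at \<open>p\<close> or higher. The offset 1
  is wrong for \<open>Leaf\<close>, where both counts are 0.\<close>

lemma peaks_dyck_word:
  "t \<noteq> Leaf \<Longrightarrow> peaks (dyck_word t) = descents (heights_of_tree t) + 1"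
proof (induction t)
  case (Node l p r)
  let ?L = "map (\<lambda>x. x + (p + 1)) (heights_of_tree l)"
  let ?R = "map (\<lambda>x. x + p) (heights_of_tree r)"
  have R: "descents (p # ?R) = descents (heights_of_tree r)"
    using pair_count_append[of "[p]" ?R "(>)"]
    by (cases "r = Leaf") (auto simp: pair_count_map hd_map)
  have "descents (?L @ p # ?R) =
      (if l = Leaf then 0 else descents (heights_of_tree l) + 1) + descents (p # ?R)"
    using pair_count_append[of ?L "p # ?R" "(>)"]
    by (cases "l = Leaf") (auto simp: pair_count_map last_map)
  then have d: "descents (heights_of_tree (Node l p r)) =
      (if l = Leaf then 0 else descents (heights_of_tree l) + 1) + descents (heights_of_tree r)"
    using R by simp
  have p0: "peaks (dyck_word (Leaf :: nat tree)) = 0" by (simp add: peaks_def)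
  show ?case unfolding d peaks_dyck_word_Node using Node.IH p0 by (cases l; cases r) auto
qed simp

section \<open>Levels and returns of Dyck words\<close>

lemma level_append:
  "level (u @ v) i =
    (if i \<le> length u then level u i else level u (length u) + level v (i - length u))"
  by (simp add: level_def)

lemma level_0 [simp]: "level w 0 = 0"
  by (simp add: level_def)

lemma level_Cons_Suc: "level (s # w) (Suc i) = (case s of Up \<Rightarrow> 1 | Down \<Rightarrow> - 1) + level w i"
  by (simp add: level_def)

lemma dyck_path_dyck_word: "dyck_path (size t) (dyck_word t)"
proof (induction t)
  case Leaf
  then show ?case by (simp add: dyck_path_def)
next
  case (Node l p r)
  have l: "level (dyck_word l) (2 * size l) = 0" "\<And>i. i \<le> 2 * size l \<Longrightarrow> level (dyck_word l) i \<ge> 0"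
   and r: "level (dyck_word r) (2 * size r) = 0" "\<And>i. i \<le> 2 * size r \<Longrightarrow> level (dyck_word r) i \<ge> 0"
    using Node.IH by (auto simp: dyck_path_def)
  have ge: "level (Up # dyck_word r @ [Down]) i \<ge> 0" if "i \<le> 2 * size r + 2" for i
  proof (cases i)
    case (Suc k)
    then show ?thesis using that r
      by (auto simp: level_Cons_Suc level_append le_Suc_eq)
  qed simp
  have "level (Up # dyck_word r @ [Down]) (2 * size r + 2) = 0"
    using r by (simp add: level_Cons_Suc level_append)
  then show ?case using l ge
    by (auto simp: dyck_path_def level_append)
qed

lemma returns_append:
  assumes "level u (length u) = 0"
  shows "returns (u @ v) = returns u + returns v"
proof -
  let ?A = "{i. i < length u \<and> u ! i = Down \<and> level u (Suc i) = 0}"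
  let ?B = "{i. i < length v \<and> v ! i = Down \<and> level v (Suc i) = 0}"
  have "{i. i < length (u @ v) \<and> (u @ v) ! i = Down \<and> level (u @ v) (Suc i) = 0}
    = ?A \<union> (\<lambda>i. i + length u) ` ?B" (is "?L = ?R")
  proof (rule set_eqI)
    fix i
    show "i \<in> ?L \<longleftrightarrow> i \<in> ?R"
    proof (cases "i < length u")
      case True
      then show ?thesis by (auto simp: nth_append level_append)
    next
      case False
      then obtain k where "i = k + length u" by (metis add.commute le_Suc_ex not_less)
      then show ?thesis using assms by (auto simp: nth_append level_append Suc_diff_le)
    qed
  qed
  moreover have "?A \<inter> (\<lambda>i. i + length u) ` ?B = {}" by auto
  ultimately show ?thesis
    by (simp add: returns_def card_Un_disjoint card_image)
qed

text \<open>Under the arch all levels are at least 1, so only the final step reaches the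
  axis.\<close>

lemma returns_Up_Down:
  assumes "dyck_path k w"
  shows "returns (Up # w @ [Down]) = 1"
proof -
  have w: "length w = 2 * k" "level w (2 * k) = 0" "\<And>i. i \<le> 2 * k \<Longrightarrow> level w i \<ge> 0"
    using assms by (auto simp: dyck_path_def)
  have "{i. i < length (Up # w @ [Down]) \<and> (Up # w @ [Down]) ! i = Down \<and>
      level (Up # w @ [Down]) (Suc i) = 0} = {2 * k + 1}" (is "?L = _")
  proof (rule set_eqI)
    fix i
    show "i \<in> ?L \<longleftrightarrow> i \<in> {2 * k + 1}"
    proof (cases "i \<le> 2 * k")
      case True
      then show ?thesis using w(3)[of i] w(1) by (auto simp: level_Cons_Suc level_append)
    next
      case False
      show ?thesis
      proof (cases "i = 2 * k + 1")
        case True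
        then show ?thesis using w(1,2) by (simp add: level_Cons_Suc level_append nth_append)
      qed (use False w(1) in auto)
    qed
  qed
  then show ?thesis by (simp add: returns_def)
qed

text \<open>Both numbers exceed those of the left subtree by one and ignore the right subtree: they
  count the nodes on the left spine.\<close>

lemma returns_dyck_word: "returns (dyck_word t) = minima (heights_of_tree t)"
proof (induction t)
  case Leaf
  then show ?case by (simp add: returns_def)
next
  case (Node l p r)
  have "returns (dyck_word (Node l p r)) = returns (dyck_word l) + 1"
    using dyck_path_dyck_word[of l] returns_Up_Down[OF dyck_path_dyck_word[of r]]
    by (simp add: returns_append dyck_path_def)
  moreover have "minima (heights_of_tree (Node l p r)) = minima (heights_of_tree l) + 1"
    by (simp add: minima_append_Cons minima_map_add[of "Suc p", simplified])
  ultimately show ?case using Node.IH by simp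
qed

text \<open>A shift-reduce parser recovers the tree from its word: an up step pushes an empty tree,
  a down step joins the two topmost trees.\<close>

fun parse_step :: "unit tree list \<Rightarrow> step \<Rightarrow> unit tree list" where
  "parse_step st Up = Leaf # st"
| "parse_step (r # l # st) Down = Node l () r # st"
| "parse_step st Down = st"

text \<open>The \<open>Leaf\<close> on top grows into the shape of \<open>t\<close> while the rest
  of the stack is untouched. Hence a word determines the shape of its tree.\<close>

lemma foldl_parse_dyck_word:
  "foldl parse_step (Leaf # st) (dyck_word t) = map_tree (\<lambda>_. ()) t # st"
  by (induction t arbitrary: st) auto

text \<open>The word read so far: consecutive trees on the stack, bottom first, are separated by the
  up steps not yet matched.\<close>

fun unparse :: "unit tree list \<Rightarrow> step list" where
  "unparse [] = []"
| "unparse [t] = dyck_word t"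
| "unparse (t # s # st) = unparse (s # st) @ [Up] @ dyck_word t"

text \<open>Invariant of the parser: the level counts the unmatched up steps, and the stack holds
  one tree more. It makes every Dyck path the word of a tree.\<close>

lemma unparse_foldl_parse:
  assumes "\<forall>i \<le> length w. level w i \<ge> 0"
  shows "int (length (foldl parse_step [Leaf] w)) = level w (length w) + 1 \<and>
    unparse (foldl parse_step [Leaf] w) = w"
  using assms
proof (induction w rule: rev_induct)
  case (snoc s w)
  let ?st = "foldl parse_step [Leaf] w"
  have "\<forall>i \<le> length w. level w i \<ge> 0"
  proof (intro allI impI)
    fix i assume "i \<le> length w"
    then show "level w i \<ge> 0" using snoc.prems[rule_format, of i] by (simp add: level_append)
  qed
  then have IH: "int (length ?st) = level w (length w) + 1" "unparse ?st = w"
    using snoc.IH by auto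
  have lev: "level (w @ [s]) (length (w @ [s])) =
      level w (length w) + (case s of Up \<Rightarrow> 1 | Down \<Rightarrow> - 1)"
    by (simp add: level_append level_Cons_Suc)
  have nonneg: "level (w @ [s]) (length (w @ [s])) \<ge> 0" using snoc.prems by blast
  show ?case
  proof (cases s)
    case Up
    have "?st \<noteq> []" using IH(1) snoc.prems \<open>\<forall>i \<le> length w. level w i \<ge> 0\<close> by auto
    then obtain t st where st: "?st = t # st" by (cases ?st) auto
    then show ?thesis using IH lev Up by simp
  next
    case Down
    \<comment> \<open>The level is still nonnegative after the down step, so it was positive before,
      and two trees are available to be joined.\<close>
    then have "length ?st \<ge> 2" using IH(1) lev nonneg by simp
    then obtain r l st where st: "?st = r # l # st"
      by (metis Suc_le_length_iff numeral_2_eq_2)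
    then show ?thesis using IH lev Down by (cases st) auto
  qed
qed simp

lemma dyck_path_imp_dyck_word:
  assumes "dyck_path k w"
  obtains t :: "unit tree" where "dyck_word t = w" "size t = k"
proof -
  have w: "length w = 2 * k" "level w (length w) = 0" "\<forall>i \<le> length w. level w i \<ge> 0"
    using assms by (auto simp: dyck_path_def)
  have "length (foldl parse_step [Leaf] w) = 1" and u: "unparse (foldl parse_step [Leaf] w) = w"
    using unparse_foldl_parse[OF w(3)] w(2) by auto
  then obtain t where "foldl parse_step [Leaf] w = [t]" by (auto simp: length_Suc_conv)
  then have "dyck_word t = w" using u by simp
  then show thesis using that w(1) by (metis length_dyck_word mult_left_cancel zero_neq_numeral)
qed

section \<open>Trees as pairs of shape and labels, and their number\<close>

text \<open>The shape fixes the size of the left subtree, and hence where the list of labels has to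
  be cut.\<close>

lemma tree_eqI_shape_inorder:
  "map_tree (\<lambda>_. ()) s = map_tree (\<lambda>_. ()) t \<Longrightarrow> inorder s = inorder t \<Longrightarrow> s = t"
proof (induction s arbitrary: t)
  case Leaf
  then show ?case by (cases t) auto
next
  case (Node l p r)
  then obtain l' p' r' where t: "t = Node l' p' r'" by (cases t) auto
  have sh: "map_tree (\<lambda>_. ()) l = map_tree (\<lambda>_. ()) l'" "map_tree (\<lambda>_. ()) r = map_tree (\<lambda>_. ()) r'"
    using Node.prems t by auto
  have "length (inorder l) = length (inorder l')"
    using sh(1) by (metis length_inorder size_map_tree)
  then show ?case using Node t sh by auto
qed

lemma ex_tree_shape_inorder:
  "length xs = size s \<Longrightarrow> \<exists>t. map_tree (\<lambda>_. ()) t = s \<and> inorder t = xs"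
proof (induction s arbitrary: xs)
  case Leaf
  then show ?case by (intro exI[of _ Leaf]) auto
next
  case (Node l u r)
  define ys where "ys = drop (size l) xs"
  have "ys \<noteq> []" using Node.prems by (simp add: ys_def)
  then have xs: "xs = take (size l) xs @ hd ys # tl ys" by (simp add: ys_def)
  obtain l' where l': "map_tree (\<lambda>_. ()) l' = l" "inorder l' = take (size l) xs"
    using Node.IH(1)[of "take (size l) xs"] Node.prems by auto
  obtain r' where r': "map_tree (\<lambda>_. ()) r' = r" "inorder r' = tl ys"
    using Node.IH(2)[of "tl ys"] Node.prems by (auto simp: ys_def)
  show ?case
    by (rule exI[of _ "Node l' (hd ys) r'"]) (use l' r' xs[symmetric] in simp)
qed

text \<open>A labelled tree is an independent choice of a Dyck path, which carries the descents and
  minima, and of \<open>m\<close> labels with sum \<open>N - (m - 1)\<close>, which carry the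
  ascent. Stars and bars count the labels.\<close>

lemma card_lists_descents_minima:
  assumes "m \<ge> 1"
  shows "card {g. length g = m \<and> ascent g = N \<and> descents g = d \<and> minima g = j}
    = R m (d + 1) j * (N choose (m - 1))" (is "card ?G = _")
proof -
  define T where "T = {t. heights_of_tree t \<in> ?G}"
  define W where "W = {w. dyck_path m w \<and> peaks w = d + 1 \<and> returns w = j}"
  \<comment> \<open>The equation is additive so that \<open>S\<close> is empty, as it must be, when
    \<open>N < m - 1\<close>.\<close>
  define S where "S = {p :: nat list. length p = m \<and> sum_list p + (m - 1) = N}"
  have "heights_of_tree ` T = ?G"
    using surj_image_vimage_eq[OF surj_heights_of_tree, of ?G] by (simp add: T_def vimage_def)
  then have GT: "card ?G = card T"
    using card_image[OF inj_on_subset[OF inj_heights_of_tree, of T]] by simp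
  have T: "t \<in> T \<longleftrightarrow> size t = m \<and> peaks (dyck_word t) = d + 1 \<and> returns (dyck_word t) = j \<and>
      sum_list (inorder t) + (m - 1) = N" for t
  proof (cases "t = Leaf")
    case False
    then show ?thesis
      by (auto simp: T_def peaks_dyck_word returns_dyck_word ascent_heights_of_tree)
  qed (use assms in \<open>auto simp: T_def\<close>)
  have "inj_on (\<lambda>t. (dyck_word t, inorder t)) T"
  proof (rule inj_onI)
    fix s t :: "nat tree" assume "(dyck_word s, inorder s) = (dyck_word t, inorder t)"
    then show "s = t"
      using foldl_parse_dyck_word[of "[]" s] foldl_parse_dyck_word[of "[]" t]
      by (intro tree_eqI_shape_inorder[of s t]) auto
  qed
  moreover have "(\<lambda>t. (dyck_word t, inorder t)) ` T = W \<times> S"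
  proof
    show "(\<lambda>t. (dyck_word t, inorder t)) ` T \<subseteq> W \<times> S"
      using dyck_path_dyck_word by (auto simp: T W_def S_def)
    show "W \<times> S \<subseteq> (\<lambda>t. (dyck_word t, inorder t)) ` T"
    proof clarify
      fix w p assume w: "w \<in> W" and p: "p \<in> S"
      obtain s :: "unit tree" where s: "dyck_word s = w" "size s = m"
        using w dyck_path_imp_dyck_word by (auto simp: W_def)
      obtain t where t: "map_tree (\<lambda>_. ()) t = s" "inorder t = p"
        using ex_tree_shape_inorder[of p s] p s by (auto simp: S_def)
      have "dyck_word t = w" "size t = m" using s t(1) by auto
      then have "t \<in> T" using w p t(2) by (simp add: T W_def S_def)
      then show "(w, p) \<in> (\<lambda>t. (dyck_word t, inorder t)) ` T"
        using \<open>dyck_word t = w\<close> t(2) by force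
    qed
  qed
  ultimately have "card T = card W * card S"
    by (metis card_image card_cartesian_product)
  moreover have "card S = N choose (m - 1)"
  proof (cases "m - 1 \<le> N")
    case True
    have "S = {p. length p = m \<and> sum_list p = N - (m - 1)}" using True by (auto simp: S_def)
    then have "card S = (N - (m - 1) + m - 1) choose (N - (m - 1))"
      by (simp add: card_length_sum_list)
    also have "N - (m - 1) + m - 1 = N" using True assms by simp
    also have "N choose (N - (m - 1)) = N choose (m - 1)" using True by (metis binomial_symmetric)
    finally show ?thesis .
  next
    case False
    then have "S = {}" by (auto simp: S_def)
    then show ?thesis using False by simp
  qed
  ultimately show ?thesis by (simp add: GT R_def W_def)
qed

section \<open>Fibonacci polyominoes as height sequences\<close>

text \<open>Normal form of a Fibonacci polyomino: \<open>(a, b)\<close> is the bottom cell of the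
  first column.\<close>

definition staircase :: "int \<Rightarrow> int \<Rightarrow> nat list \<Rightarrow> cell set" where
  "staircase a b h = {(x, y). a \<le> x \<and> x < a + int (length h) \<and>
     b + (x - a) \<le> y \<and> y < b + (x - a) + int (h ! nat (x - a))}"

lemma staircase_Nil [simp]: "staircase a b [] = {}"
  by (auto simp: staircase_def)

lemma staircase_Cons:
  "staircase a b (k # h) = {a} \<times> {b..<b + int k} \<union> staircase (a + 1) (b + 1) h"
proof (rule set_eqI, clarify)
  fix x y
  show "(x, y) \<in> staircase a b (k # h) \<longleftrightarrow>
    (x, y) \<in> {a} \<times> {b..<b + int k} \<union> staircase (a + 1) (b + 1) h"
  proof (cases "x \<le> a")
    case True
    then show ?thesis by (cases "x = a") (auto simp: staircase_def)
  next
    case False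
    define i where "i = nat (x - (a + 1))"
    have "nat (x - a) = Suc i" "x = a + 1 + int i" using False by (auto simp: i_def)
    then show ?thesis by (auto simp: staircase_def)
  qed
qed

lemma column_staircase:
  "i < length h \<Longrightarrow> column (staircase a b h) (a + int i) = {b + int i..<b + int i + int (h ! i)}"
  by (auto simp: column_def staircase_def)

lemma column_staircase_ne:
  assumes "column (staircase a b h) x \<noteq> {}"
  obtains i where "i < length h" "x = a + int i"
proof
  show "nat (x - a) < length h" "x = a + int (nat (x - a))"
    using assms by (auto simp: column_def staircase_def)
qed

lemma translate_staircase: "translate t (staircase a b h) = staircase (a + fst t) (b + snd t) h"
proof (rule set_eqI, clarify)
  fix x y
  have "(x, y) \<in> translate t (staircase a b h) \<longleftrightarrow> (x - fst t, y - snd t) \<in> staircase a b h"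
    unfolding translate_def by (force simp: image_iff)
  also have "\<dots> \<longleftrightarrow> (x, y) \<in> staircase (a + fst t) (b + snd t) h"
    by (auto simp: staircase_def algebra_simps)
  finally show "(x, y) \<in> translate t (staircase a b h) \<longleftrightarrow>
    (x, y) \<in> staircase (a + fst t) (b + snd t) h" .
qed

fun fibonacci_heights :: "nat list \<Rightarrow> bool" where
  "fibonacci_heights [] = False"
| "fibonacci_heights [k] = (k \<ge> 1)"
| "fibonacci_heights (k # l # h) = (k \<ge> 2 \<and> fibonacci_heights (l # h))"

lemma fibonacci_heights_iff:
  "fibonacci_heights h \<longleftrightarrow> h \<noteq> [] \<and> (\<forall>i < length h. h ! i \<ge> 1) \<and>
    (\<forall>i. Suc i < length h \<longrightarrow> h ! i \<ge> 2)"
proof (induction h rule: fibonacci_heights.induct)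
  case (3 k l h)
  show ?case unfolding fibonacci_heights.simps(3) 3
    by (auto simp: nth_Cons split: nat.splits)
qed auto

lemma fibonacci_heights_snoc:
  "fibonacci_heights (g @ [k]) \<longleftrightarrow> (\<forall>x \<in> set g. x \<ge> 2) \<and> k \<ge> 1"
proof (induction g)
  case (Cons x g)
  then show ?case by (cases g) auto
qed simp

text \<open>Positive heights ensure that each column position occurs among the first coordinates. As
  the result does not mention \<open>a\<close> and \<open>b\<close>, heights are invariant under
  translation.\<close>

lemma column_heights_staircase:
  assumes "fibonacci_heights h"
  shows "column_heights (staircase a b h) = h"
proof -
  let ?xs = "map (\<lambda>i. a + int i) [0..<length h]"
  have pos: "h ! i \<ge> 1" if "i < length h" for i
    using assms that by (auto simp: fibonacci_heights_iff)
  have "fst ` staircase a b h = set ?xs"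
  proof
    show "fst ` staircase a b h \<subseteq> set ?xs"
    proof
      fix x assume "x \<in> fst ` staircase a b h"
      then have "column (staircase a b h) x \<noteq> {}" by (auto simp: column_def)
      then obtain i where "i < length h" "x = a + int i" by (rule column_staircase_ne)
      then show "x \<in> set ?xs" by auto
    qed
    show "set ?xs \<subseteq> fst ` staircase a b h"
    proof
      fix x assume "x \<in> set ?xs"
      then obtain i where i: "i < length h" "x = a + int i" by auto
      then have "(x, b + int i) \<in> staircase a b h" using pos[of i] by (auto simp: staircase_def)
      then show "x \<in> fst ` staircase a b h" by force
    qed
  qed
  moreover have "sorted ?xs" "distinct ?xs"
    by (auto simp: sorted_iff_nth_mono distinct_map inj_on_def)
  ultimately have "sorted_list_of_set (fst ` staircase a b h) = ?xs"
    using sorted_list_of_set.idem_if_sorted_distinct by metis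
  then show ?thesis
    by (intro nth_equalityI) (auto simp: column_heights_def column_staircase)
qed

lemma finite_staircase [simp]: "finite (staircase a b h)"
  by (induction h arbitrary: a b) (auto simp: staircase_Cons)

section \<open>Connectedness, and the normal form of a Fibonacci polyomino\<close>

definition adjacency :: "cell set \<Rightarrow> (cell \<times> cell) set" where
  "adjacency P = {(c, c'). c \<in> P \<and> c' \<in> P \<and> adjacent c c'}"

lemma adjacency_mono: "P \<subseteq> Q \<Longrightarrow> (adjacency P)\<^sup>* \<subseteq> (adjacency Q)\<^sup>*"
  by (intro rtrancl_mono) (auto simp: adjacency_def)

lemma sym_adjacency: "sym ((adjacency P)\<^sup>*)"
  by (intro sym_rtrancl) (auto simp: sym_def adjacency_def adjacent_def)

lemma column_connected:
  assumes "{a} \<times> {b..<b + int k} \<subseteq> P" "i < k"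
  shows "((a, b), (a, b + int i)) \<in> (adjacency P)\<^sup>*"
  using assms(2)
proof (induction i)
  case (Suc i)
  have "((a, b + int i), (a, b + int (Suc i))) \<in> adjacency P"
    using Suc.prems assms(1) by (auto simp: adjacency_def adjacent_def)
  then show ?case using Suc by (meson Suc_lessD rtrancl.rtrancl_into_rtrancl)
qed simp

text \<open>When another column follows, \<open>k \<ge> 2\<close> provides the cell
  \<open>(a, b + 1)\<close>, whose right neighbour is the bottom cell of the next column; the path
  continues from there by induction.\<close>

lemma staircase_connected:
  "fibonacci_heights h \<Longrightarrow> c \<in> staircase a b h \<Longrightarrow> ((a, b), c) \<in> (adjacency (staircase a b h))\<^sup>*"
proof (induction h arbitrary: a b)
  case (Cons k h)
  let ?P = "staircase a b (k # h)"
  have sub: "{a} \<times> {b..<b + int k} \<subseteq> ?P" by (auto simp: staircase_Cons)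
  show ?case
  proof (cases "fst c = a")
    case True
    then have c: "c = (a, b + int (nat (snd c - b)))" "nat (snd c - b) < k"
      using Cons.prems by (auto simp: staircase_def prod_eq_iff)
    show ?thesis using column_connected[OF sub c(2)] c(1) by simp
  next
    case False
    then have c: "c \<in> staircase (a + 1) (b + 1) h" using Cons.prems by (auto simp: staircase_Cons)
    then obtain l h' where h: "h = l # h'" by (cases h) auto
    have k: "k \<ge> 2" and fh: "fibonacci_heights h" using Cons.prems h by auto
    have "l \<ge> 1" using fh h by (cases h') auto
    have "((a + 1, b + 1), c) \<in> (adjacency ?P)\<^sup>*"
      using Cons.IH[OF fh c] adjacency_mono[of "staircase (a + 1) (b + 1) h" ?P]
      by (auto simp: staircase_Cons)
    moreover have "((a, b), (a, b + 1)) \<in> (adjacency ?P)\<^sup>*"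
      using column_connected[OF sub, of 1] k by simp
    moreover have "((a, b + 1), (a + 1, b + 1)) \<in> adjacency ?P"
      using k \<open>l \<ge> 1\<close> by (auto simp: adjacency_def adjacent_def staircase_Cons h)
    ultimately show ?thesis by (meson rtrancl.rtrancl_into_rtrancl rtrancl_trans)
  qed
qed simp

lemma polyomino_altdef:
  "polyomino P \<longleftrightarrow> finite P \<and> P \<noteq> {} \<and> (\<forall>c\<in>P. \<forall>c'\<in>P. (c, c') \<in> (adjacency P)\<^sup>*)"
  by (simp add: polyomino_def adjacency_def)

lemma Min_atLeastLessThan_int: "a < (b::int) \<Longrightarrow> Min {a..<b} = a"
  by (rule Min_eqI) auto

lemma fibonacci_polyomino_staircase:
  assumes "fibonacci_heights h"
  shows "fibonacci_polyomino (staircase a b h)"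
  unfolding fibonacci_polyomino_def polyomino_altdef
proof (intro conjI ballI allI impI)
  let ?P = "staircase a b h"
  have pos: "h ! i \<ge> 1" if "i < length h" for i
    using assms that by (auto simp: fibonacci_heights_iff)
  have "(a, b) \<in> ?P" using pos[of 0] assms by (auto simp: staircase_def fibonacci_heights_iff)
  then show "?P \<noteq> {}" by blast
  show "(c, c') \<in> (adjacency ?P)\<^sup>*" if "c \<in> ?P" "c' \<in> ?P" for c c'
    using staircase_connected[OF assms that(1)] staircase_connected[OF assms that(2)] sym_adjacency
    by (meson rtrancl_trans symD)
  show "column_convex ?P"
    unfolding column_convex_def
  proof
    fix x
    show "\<exists>u v. column ?P x = {u..v}"
    proof (cases "column ?P x = {}")
      case True
      then show ?thesis by (intro exI[of _ 1] exI[of _ 0]) simp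
    next
      case False
      then obtain i where "i < length h" "x = a + int i" by (rule column_staircase_ne)
      then have "column ?P x = {b + int i..b + int i + int (h ! i) - 1}"
        by (auto simp: column_staircase)
      then show ?thesis by blast
    qed
  qed
  fix x assume x: "column ?P x \<noteq> {} \<and> column ?P (x + 1) \<noteq> {}"
  obtain i where i: "i < length h" "x = a + int i" using x column_staircase_ne by blast
  obtain i' where i': "i' < length h" "x + 1 = a + int i'" using x column_staircase_ne by blast
  have "i' = Suc i" using i i' by simp
  then show "Min (column ?P (x + 1)) = Min (column ?P x) + 1"
    unfolding i'(2) unfolding i(2) column_staircase[OF i(1)] column_staircase[OF i'(1)]
    using pos[OF i(1)] pos[OF i'(1)] by (simp add: Min_atLeastLessThan_int)
qed simp

text \<open>Some step of the path goes from column \<open>x\<close> to column \<open>x + 1\<close>,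
  and a step that changes the column keeps the row.\<close>

lemma adjacency_crossing:
  assumes "(c, c') \<in> (adjacency P)\<^sup>*" "fst c \<le> x" "x < fst c'"
  obtains y where "(x, y) \<in> P" "(x + 1, y) \<in> P"
proof -
  have "\<exists>y. (x, y) \<in> P \<and> (x + 1, y) \<in> P"
    using assms
  proof (induction rule: rtrancl_induct)
    case (step d e)
    show ?case
    proof (cases "x < fst d")
      case False
      have "d \<in> P" "e \<in> P" "adjacent d e" using step.hyps(2) by (auto simp: adjacency_def)
      moreover from this have "d = (x, snd d)" "e = (x + 1, snd d)"
        using False step.prems by (auto simp: adjacent_def prod_eq_iff abs_if split: if_splits)
      ultimately show ?thesis by metis
    qed (use step in blast)
  qed simp
  then show thesis using that by blast
qed

text \<open>A path from the leftmost to the rightmost column crosses every gap, so no column between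
  is empty and consecutive columns share a row. Convexity makes the columns intervals, and the
  condition on minima places their bottoms at \<open>b + int i\<close>.\<close>

lemma fibonacci_polyomino_imp_staircase:
  assumes "fibonacci_polyomino P"
  obtains a b h where "P = staircase a b h" "fibonacci_heights h"
proof -
  have fin: "finite P" and ne: "P \<noteq> {}"
    and conn: "\<And>c c'. c \<in> P \<Longrightarrow> c' \<in> P \<Longrightarrow> (c, c') \<in> (adjacency P)\<^sup>*"
    and conv: "\<And>x. \<exists>u v. column P x = {u..v}"
    and Mins: "\<And>x. column P x \<noteq> {} \<Longrightarrow> column P (x + 1) \<noteq> {} \<Longrightarrow>
      Min (column P (x + 1)) = Min (column P x) + 1"
    using assms by (auto simp: fibonacci_polyomino_def polyomino_altdef column_convex_def)
  define a where "a = Min (fst ` P)"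
  define z where "z = Max (fst ` P)"
  define b where "b = Min (column P a)"
  define h where "h = map (\<lambda>i. card (column P (a + int i))) [0..<nat (z - a + 1)]"
  have "a \<in> fst ` P" "z \<in> fst ` P" using fin ne by (auto simp: a_def z_def)
  then obtain ya yz where ya: "(a, ya) \<in> P" and yz: "(z, yz) \<in> P" by auto
  have bounds: "a \<le> x" "x \<le> z" if "(x, y) \<in> P" for x y
    using that fin by (force simp: a_def z_def intro: Min_le Max_ge)+
  have "a \<le> z" using bounds ya by blast
  have len: "length h = nat (z - a + 1)" by (simp add: h_def)
  have overlap: "\<exists>y. (x, y) \<in> P \<and> (x + 1, y) \<in> P" if "a \<le> x" "x < z" for x
    using adjacency_crossing[OF conn[OF ya yz], of x] that by auto
  have colne: "column P x \<noteq> {}" if "a \<le> x" "x \<le> z" for x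
    using overlap[of x] yz that by (cases "x = z") (auto simp: column_def)
  have Min_col: "i < length h \<Longrightarrow> Min (column P (a + int i)) = b + int i" for i
  proof (induction i)
    case (Suc i)
    have "Min (column P (a + int i + 1)) = Min (column P (a + int i)) + 1"
      using Suc.prems len by (intro Mins colne) auto
    then show ?case using Suc by (simp add: algebra_simps)
  qed (simp add: b_def)
  have col: "column P (a + int i) = {b + int i..<b + int i + int (h ! i)} \<and> h ! i \<ge> 1"
    if i: "i < length h" for i
  proof -
    obtain u v where uv: "column P (a + int i) = {u..v}" using conv by blast
    have "column P (a + int i) \<noteq> {}" using i len by (intro colne) auto
    then have le: "u \<le> v" using uv by simp
    then have "Min {u..v} = u" by (intro Min_eqI) auto
    then have u: "u = b + int i" using Min_col[OF i] uv by simp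
    have "h ! i = card (column P (a + int i))" using i len by (simp add: h_def)
    then have "h ! i = nat (v - u + 1)" unfolding uv by simp
    then show ?thesis unfolding uv u using le u by auto
  qed
  have "P = staircase a b h"
  proof (rule set_eqI, clarify)
    fix x y
    show "(x, y) \<in> P \<longleftrightarrow> (x, y) \<in> staircase a b h"
    proof (cases "a \<le> x \<and> x \<le> z")
      case True
      define i where "i = nat (x - a)"
      have x: "x = a + int i" "i < length h" using True by (auto simp: i_def len)
      have "(x, y) \<in> P \<longleftrightarrow> y \<in> column P x" by (simp add: column_def)
      also have "\<dots> \<longleftrightarrow> y \<in> column (staircase a b h) x" using x col column_staircase by simp
      finally show ?thesis by (simp add: column_def)
    next
      case False
      then show ?thesis using bounds \<open>a \<le> z\<close> by (auto simp: staircase_def len)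
    qed
  qed
  moreover have "fibonacci_heights h"
    unfolding fibonacci_heights_iff
  proof (intro conjI allI impI)
    show "h \<noteq> []" using len \<open>a \<le> z\<close> by auto
    show "1 \<le> h ! i" if "i < length h" for i using col that by simp
    fix i assume i: "Suc i < length h"
    then have "a + int i < z" using len by linarith
    then obtain y where "(a + int i, y) \<in> P" "(a + int i + 1, y) \<in> P"
      using overlap[of "a + int i"] by auto
    \<comment> \<open>The shared row \<open>y\<close> lies at or above the next bottom,
      \<open>b + int i + 1\<close>, so column \<open>i\<close> has a second cell.\<close>
    then have "y \<in> column P (a + int i)" "y \<in> column P (a + int (Suc i))"
      by (auto simp: column_def algebra_simps)
    then show "2 \<le> h ! i" using col[of i] col[of "Suc i"] i by auto
  qed
  ultimately show thesis by (rule that)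
qed

section \<open>Boundary edges and semiperimeters\<close>

text \<open>A unit edge borders two cells \<open>p\<close> and \<open>q\<close>; it is on the
  boundary when exactly one of them belongs to \<open>P\<close>.\<close>

lemma ex1_mem_pair_iff: "p \<noteq> q \<Longrightarrow> (\<exists>!c. c \<in> P \<and> (c = p \<or> c = q)) \<longleftrightarrow> (p \<in> P \<longleftrightarrow> q \<notin> P)"
  by metis

lemma horizontal_boundary:
  "{e. \<exists>!c. c \<in> P \<and> e \<in> horizontal_edges c} = {(x, y). (x, y) \<in> P \<longleftrightarrow> (x, y - 1) \<notin> P}"
proof (rule set_eqI, clarify)
  fix x y
  have "(c \<in> P \<and> (x, y) \<in> horizontal_edges c) \<longleftrightarrow> c \<in> P \<and> (c = (x, y) \<or> c = (x, y - 1))" for c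
    by (cases c) (auto simp: horizontal_edges_def)
  then show "(x, y) \<in> {e. \<exists>!c. c \<in> P \<and> e \<in> horizontal_edges c} \<longleftrightarrow>
      (x, y) \<in> {(x, y). (x, y) \<in> P \<longleftrightarrow> (x, y - 1) \<notin> P}"
    by (simp only: mem_Collect_eq case_prod_conv) (rule ex1_mem_pair_iff, simp)
qed

lemma vertical_boundary:
  "{e. \<exists>!c. c \<in> P \<and> e \<in> vertical_edges c} = {(x, y). (x, y) \<in> P \<longleftrightarrow> (x - 1, y) \<notin> P}"
proof (rule set_eqI, clarify)
  fix x y
  have "(c \<in> P \<and> (x, y) \<in> vertical_edges c) \<longleftrightarrow> c \<in> P \<and> (c = (x, y) \<or> c = (x - 1, y))" for c
    by (cases c) (auto simp: vertical_edges_def)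
  then show "(x, y) \<in> {e. \<exists>!c. c \<in> P \<and> e \<in> vertical_edges c} \<longleftrightarrow>
      (x, y) \<in> {(x, y). (x, y) \<in> P \<longleftrightarrow> (x - 1, y) \<notin> P}"
    by (simp only: mem_Collect_eq case_prod_conv) (rule ex1_mem_pair_iff, simp)
qed

lemma staircase_fst_ge: "(x, y) \<in> staircase a b h \<Longrightarrow> a \<le> x"
  by (simp add: staircase_def)

lemma horizontal_semiperimeter_staircase:
  assumes "\<forall>k \<in> set h. k \<ge> 1"
  shows "horizontal_semiperimeter (staircase a b h) = real (length h)"
proof -
  define H where "H P = {(x, y). (x, y) \<in> P \<longleftrightarrow> (x, y - 1) \<notin> P}" for P :: "cell set"
  have "finite (H (staircase a b h)) \<and> card (H (staircase a b h)) = 2 * length h"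
    using assms
  proof (induction h arbitrary: a b)
    case (Cons k h)
    let ?C = "{(a, b), (a, b + int k)}"
    let ?S = "staircase (a + 1) (b + 1) h"
    have "(x, y) \<in> H (staircase a b (k # h)) \<longleftrightarrow> (x, y) \<in> ?C \<union> H ?S" for x y
    proof (cases "x = a")
      case True
      then show ?thesis using Cons.prems
        by (auto simp: H_def staircase_Cons dest: staircase_fst_ge)
    next
      case False
      then show ?thesis by (auto simp: H_def staircase_Cons)
    qed
    then have "H (staircase a b (k # h)) = ?C \<union> H ?S" by (auto simp del: Un_iff)
    moreover have "?C \<inter> H ?S = {}" by (auto simp: H_def dest: staircase_fst_ge)
    moreover have "card ?C = 2" using Cons.prems by simp
    moreover have "finite (H ?S) \<and> card (H ?S) = 2 * length h" using Cons by simp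
    ultimately show ?case by (simp add: card_Un_disjoint del: Un_insert_left)
  qed (simp add: H_def)
  then show ?thesis by (simp add: horizontal_semiperimeter_def horizontal_boundary H_def)
qed

text \<open>Rows where exactly one of two neighbouring columns has a cell: the bottom row
  \<open>b\<close> of the first, and the rows between the two tops.\<close>

lemma card_symdiff_columns:
  assumes "k \<ge> 2" "l \<ge> 1"
  shows "finite {y. (b \<le> y \<and> y < b + int k) \<noteq> (b + 1 \<le> y \<and> y < b + 1 + int l)}"
    and "int (card {y. (b \<le> y \<and> y < b + int k) \<noteq> (b + 1 \<le> y \<and> y < b + 1 + int l)})
      = 1 + \<bar>int k - (int l + 1)\<bar>"
proof -
  have eq: "{y. (b \<le> y \<and> y < b + int k) \<noteq> (b + 1 \<le> y \<and> y < b + 1 + int l)}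
    = insert b {min (b + int k) (b + 1 + int l)..<max (b + int k) (b + 1 + int l)}"
    using assms by auto
  show "finite {y. (b \<le> y \<and> y < b + int k) \<noteq> (b + 1 \<le> y \<and> y < b + 1 + int l)}"
    unfolding eq by simp
  show "int (card {y. (b \<le> y \<and> y < b + int k) \<noteq> (b + 1 \<le> y \<and> y < b + 1 + int l)})
      = 1 + \<bar>int k - (int l + 1)\<bar>"
    unfolding eq using assms by (subst card_insert_disjoint) auto
qed

text \<open>Prepending a column of height \<open>k\<close> adds \<open>k\<close> edges on its left
  side and replaces the \<open>l\<close> edges on the left side of the old first column by the
  symmetric difference \<open>?D\<close>. The other edges, collected in \<open>W\<close>,
  remain.\<close>

lemma vertical_semiperimeter_staircase:
  assumes "fibonacci_heights h"
  shows "vertical_semiperimeter (staircase a b h) = real (ascent h)"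
proof -
  define V where "V P = {(x, y). (x, y) \<in> P \<longleftrightarrow> (x - 1, y) \<notin> P}" for P :: "cell set"
  have "finite (V (staircase a b h)) \<and> card (V (staircase a b h)) = 2 * ascent h"
    using assms
  proof (induction h arbitrary: a b rule: fibonacci_heights.induct)
    case (2 k)
    have "V (staircase a b [k]) = {a} \<times> {b..<b + int k} \<union> {a + 1} \<times> {b..<b + int k}"
      by (auto simp: V_def staircase_Cons)
    moreover have "card ({a} \<times> {b..<b + int k} \<union> {a + 1} \<times> {b..<b + int k}) = 2 * k"
      by (subst card_Un_disjoint) (auto simp: card_cartesian_product)
    ultimately show ?case by (simp add: ascent_def)
  next
    case (3 k l h)
    let ?S = "staircase (a + 1) (b + 1) (l # h)"
    let ?D = "{y. (b \<le> y \<and> y < b + int k) \<noteq> (b + 1 \<le> y \<and> y < b + 1 + int l)}"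
    define L where "L = {a + 1} \<times> {b + 1..<b + 1 + int l}"
    define W where "W = {(x, y) \<in> V ?S. x > a + 1}"
    have k: "k \<ge> 2" and fh: "fibonacci_heights (l # h)" using 3 by auto
    have l: "l \<ge> 1" using fh by (cases h) auto
    have IH: "finite (V ?S)" "card (V ?S) = 2 * ascent (l # h)" using 3 by auto
    have "(x, y) \<in> V ?S \<longleftrightarrow> (x, y) \<in> L \<union> W" for x y
      by (cases "x = a + 1")
        (auto simp: V_def L_def W_def staircase_Cons dest: staircase_fst_ge)
    then have VS: "V ?S = L \<union> W" by (auto simp del: Un_iff)
    then have fin: "finite W" using IH(1) by simp
    have "card (V ?S) = card L + card W" unfolding VS
      using fin by (subst card_Un_disjoint) (auto simp: L_def W_def)
    then have W: "l + card W = 2 * ascent (l # h)"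
      using IH(2) by (simp add: L_def card_cartesian_product)
    have "(x, y) \<in> V (staircase a b (k # l # h)) \<longleftrightarrow>
        (x, y) \<in> {a} \<times> {b..<b + int k} \<union> ({a + 1} \<times> ?D \<union> W)" for x y
    proof -
      consider "x < a" | "x = a" | "x = a + 1" | "x > a + 1" by linarith
      then show ?thesis
        by cases (auto simp: V_def W_def staircase_Cons dest: staircase_fst_ge)
    qed
    then have V: "V (staircase a b (k # l # h)) = {a} \<times> {b..<b + int k} \<union> ({a + 1} \<times> ?D \<union> W)"
      by (auto simp del: Un_iff)
    have D: "finite ?D" "int (card ?D) = 1 + \<bar>int k - (int l + 1)\<bar>"
      using card_symdiff_columns[OF k l] by auto
    have "card ({a + 1} \<times> ?D \<union> W) = card ?D + card W"
      using D(1) fin by (subst card_Un_disjoint) (auto simp: W_def card_cartesian_product)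
    moreover have "card (V (staircase a b (k # l # h))) = k + card ({a + 1} \<times> ?D \<union> W)"
      unfolding V using D(1) fin
      by (subst card_Un_disjoint) (auto simp: W_def card_cartesian_product)
    moreover have "finite (V (staircase a b (k # l # h)))" unfolding V using D(1) fin by simp
    \<comment> \<open>With \<open>x = int l + 1 - int k\<close>, the identity
      \<open>x + \<bar>x\<bar> = 2 * max 0 x\<close> turns the edge count into twice the truncated
      rise.\<close>
    ultimately show ?case using W D(2) k by (auto simp: ascent_def)
  qed simp
  then show ?thesis by (simp add: vertical_semiperimeter_def vertical_boundary V_def)
qed

section \<open>From translation classes to the final count\<close>

text \<open>Each translation class contains exactly one staircase based at the origin: moving the
  base point is a translation, and the heights are recovered from any translate.\<close>

lemma card_fibonacci_polyominoes:
  "card ({P \<in> fibonacci_polyominoes m n. des P = d \<and> lmin P = j} // translation_rel)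
    = card {h. fibonacci_heights h \<and> length h = m \<and> ascent h = n \<and> descents h = d \<and> minima h = j}"
  (is "card (?X // _) = card ?H")
proof -
  have staircase_in: "staircase a b h \<in> ?X \<longleftrightarrow> h \<in> ?H" if "fibonacci_heights h" for a b h
  proof -
    have "\<forall>k \<in> set h. k \<ge> 1" using that by (auto simp: fibonacci_heights_iff in_set_conv_nth)
    then show ?thesis
      using that fibonacci_polyomino_staircase[OF that] vertical_semiperimeter_staircase[OF that]
      by (simp add: fibonacci_polyominoes_def horizontal_semiperimeter_staircase des_def lmin_def
          column_heights_staircase minima_def pair_count_def)
  qed
  have rel: "(staircase a b h, staircase a' b' h) \<in> translation_rel" for a b a' b' h
    unfolding translation_rel_def
    using translate_staircase[of "(a' - a, b' - b)" a b h] by auto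
  let ?f = "\<lambda>h. translation_rel `` {staircase 0 0 h}"
  have "?X // translation_rel = ?f ` ?H"
  proof
    show "?X // translation_rel \<subseteq> ?f ` ?H"
    proof
      fix K assume "K \<in> ?X // translation_rel"
      then obtain P where P: "P \<in> ?X" "K = translation_rel `` {P}" by (rule quotientE)
      then obtain a b h where h: "P = staircase a b h" "fibonacci_heights h"
        using fibonacci_polyomino_imp_staircase[of P] unfolding fibonacci_polyominoes_def by blast
      then have "h \<in> ?H" using P staircase_in by blast
      moreover have "K = ?f h" using rel P h equiv_class_eq[OF equiv_translation_rel] by metis
      ultimately show "K \<in> ?f ` ?H" by blast
    qed
    show "?f ` ?H \<subseteq> ?X // translation_rel"
      using staircase_in by (auto intro!: quotientI)
  qed
  moreover have "inj_on ?f ?H"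
  proof (rule inj_onI)
    fix h h' assume h: "h \<in> ?H" "h' \<in> ?H" "?f h = ?f h'"
    then have "(staircase 0 0 h, staircase 0 0 h') \<in> translation_rel"
      using eq_equiv_class[OF _ equiv_translation_rel] by blast
    then obtain t where "staircase 0 0 h' = translate t (staircase 0 0 h)"
      by (auto simp: translation_rel_def)
    then show "h = h'" using h column_heights_staircase by (simp add: translate_staircase) metis
  qed
  ultimately show ?thesis by (simp add: card_image)
qed

text \<open>Subtracting 2 from every height keeps descents and minima and lowers the ascent of a
  nonempty sequence by 2, through its first entry only.\<close>

lemma card_heights_ge_2:
  assumes "m \<ge> 1" "n \<ge> 2"
  shows "card {h. (\<forall>x \<in> set h. x \<ge> 2) \<and> length h = m \<and> ascent h = n \<and> descents h = d \<and> minima h = j}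
    = R m (d + 1) j * ((n - 2) choose (m - 1))" (is "card ?H = _")
proof -
  let ?G = "{g. length g = m \<and> ascent g = n - 2 \<and> descents g = d \<and> minima g = j}"
  let ?f = "map (\<lambda>x::nat. x + 2)"
  have iff: "?f g \<in> ?H \<longleftrightarrow> g \<in> ?G" for g
    using assms ascent_map_add[of g 2]
    by (cases "g = []") (auto simp: minima_map_add[of 2, simplified] pair_count_map)
  have "?H = ?f ` ?G"
  proof
    show "?H \<subseteq> ?f ` ?G"
    proof
      fix h assume h: "h \<in> ?H"
      have "h = ?f (map (\<lambda>x. x - 2) h)"
        using h by (auto intro!: map_idI[symmetric] simp: le_add_diff_inverse2)
      then show "h \<in> ?f ` ?G" using h iff by (metis (no_types, lifting) image_eqI)
    qed
    show "?f ` ?G \<subseteq> ?H" using iff by blast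
  qed
  moreover have "inj_on ?f ?G" by (auto simp: inj_on_def inj_map_eq_map)
  ultimately have "card ?H = card ?G" by (simp add: card_image)
  then show ?thesis using card_lists_descents_minima[OF assms(1)] by simp
qed

text \<open>Supplies the case \<open>d = 0\<close> of the theorem, where no polyomino ends in a
  column of height 1 and the second summand has to vanish.\<close>

lemma R_no_peaks: "l \<ge> 1 \<Longrightarrow> R l 0 j = 0"
proof -
  assume l: "l \<ge> 1"
  have "peaks w \<noteq> 0" if w: "dyck_path l w" for w
  proof -
    obtain s :: "unit tree" where s: "dyck_word s = w" "size s = l"
      using w by (rule dyck_path_imp_dyck_word)
    then obtain a b where "s = Node a () b" using l by (cases s) auto
    then show ?thesis using s(1) by (auto simp: peaks_dyck_word_Node simp del: dyck_word.simps)
  qed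
  then have "{w. dyck_path l w \<and> peaks w = 0 \<and> returns w = j} = {}" by blast
  then show ?thesis unfolding R_def by (simp only: card.empty)
qed

theorem theorem4p1:
  fixes m n d j :: nat
  assumes "m \<ge> 2" and "n \<ge> 2" and "j \<ge> 1"
  shows "card ({P \<in> fibonacci_polyominoes m n. des P = d \<and> lmin P = j} // translation_rel)
    = R m (d + 1) j * ((n - 2) choose (m - 1))
      + R (m - 1) d (j - 1) * ((n - 2) choose (m - 2))"
proof -
  let ?H = "{h. fibonacci_heights h \<and> length h = m \<and> ascent h = n \<and> descents h = d \<and> minima h = j}"
  let ?A = "{h. (\<forall>x \<in> set h. x \<ge> 2) \<and> length h = m \<and> ascent h = n \<and> descents h = d \<and> minima h = j}"
  \<comment> \<open>Writing \<open>descents g + 1 = d\<close> makes this set empty for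
    \<open>d = 0\<close>, unlike a truncated \<open>d - 1\<close>.\<close>
  let ?B = "{g. (\<forall>x \<in> set g. x \<ge> 2) \<and> length g = m - 1 \<and> ascent g = n \<and>
      descents g + 1 = d \<and> minima g = j - 1}"
  \<comment> \<open>After a last height of at least 2 the rise \<open>1 + 1 - last g\<close> is 0,
    so the ascent is kept; the final 1 is a descent and lies strictly below all earlier
    heights.\<close>
  have snoc_1: "g @ [1] \<in> ?H \<longleftrightarrow> g \<in> ?B" if "\<forall>x \<in> set g. x \<ge> 2" for g
  proof (cases "g = []")
    case False
    then have "Suc (Suc 0) \<le> last g" "\<forall>x \<in> set g. x > 1"
      using that by (fastforce simp: numeral_2_eq_2)+
    then show ?thesis using False that assms
      by (auto simp: fibonacci_heights_snoc ascent_def rises_append pair_count_append minima_snoc)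
  qed (use assms in auto)
  have "?H = ?A \<union> (\<lambda>g. g @ [1]) ` ?B"
  proof (rule set_eqI)
    fix h
    show "h \<in> ?H \<longleftrightarrow> h \<in> ?A \<union> (\<lambda>g. g @ [1]) ` ?B"
    proof (cases h rule: rev_cases)
      case Nil
      then show ?thesis using assms by auto
    next
      case (snoc g k)
      show ?thesis
      proof (cases "k = 1")
        case True
        then show ?thesis using snoc snoc_1[of g]
          by (auto simp: fibonacci_heights_snoc)
      next
        case False
        then show ?thesis using snoc by (auto simp: fibonacci_heights_snoc)
      qed
    qed
  qed
  moreover have "?A \<inter> (\<lambda>g. g @ [1]) ` ?B = {}"
  proof -
    have "g @ [1] \<notin> ?A" for g by simp
    then show ?thesis by blast
  qed
  moreover have "finite ?A" by (rule finite_subset[OF _ finite_ascent_eq[of m n]]) blast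
  moreover have "finite ?B" by (rule finite_subset[OF _ finite_ascent_eq[of "m - 1" n]]) blast
  moreover have "inj_on (\<lambda>g. g @ [1]) ?B" by (simp add: inj_on_def)
  ultimately have "card ?H = card ?A + card ?B"
    by (simp only: card_Un_disjoint card_image finite_imageI)
  moreover have "card ?B = R (m - 1) d (j - 1) * ((n - 2) choose (m - 2))"
  proof (cases d)
    case 0
    then show ?thesis using R_no_peaks[of "m - 1"] assms by simp
  next
    case (Suc d')
    then show ?thesis
      using card_heights_ge_2[of "m - 1" n d' "j - 1"] assms by (simp add: numeral_2_eq_2)
  qed
  ultimately show ?thesis
    using card_fibonacci_polyominoes card_heights_ge_2[of m n d j] assms by simp
qed

end
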